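(* Let $1\le n<n'$ be two integers. Let $I\subset T_n$ be a nonzero monomial ideal and let $1\ne v\in T_{n'}$ be a monomial with $\operatorname{supp}(v)\subset\{x_{n+1},\ldots,x_{n'}\}$. Let $J=(I,v)\subset T_{n'}$. Then $I$ is smoothly spreadable (as an ideal of $T_n$) if and only if $J$ is smoothly spreadable (as an ideal of $T_{n'}$).
   Context: $K$ is a field, $T=K[x_1,x_2,\ldots]$ and $T_n=K[x_1,\ldots,x_n]$. The support of a monomial $u$ is $\operatorname{supp}(u)=\{x_j: x_j\mid u\}$. For a monomial $u=x_{i_1}\cdots x_{i_d}$ with $i_1\le\cdots\le i_d$, set $\sigma(u):=x_{i_1}x_{i_2+1}\cdots x_{i_d+d-1}$, and $\sigma^t(u):=\sigma(\sigma^{t-1}(u))$, so $\sigma^t(u)=x_{i_1}x_{i_2+t}\cdots x_{i_d+(d-1)t}$. For a nonzero monomial ideal $I$, $G(I)$ is its set of minimal monomial generators and $\deg(I)$ is the maximal degree of an element of $G(I)$. For a monomial $u=x_1^{a_1}\cdots x_n^{a_n}\in T_n$, its polarization with respect to $T_n$ is $u^p:=\prod_{j=1}^n\prod_{k=0}^{a_j-1}x_{kn+j}$. A monomial ideal $I\subset T_n$ with $\deg(I)=d$ is smoothly spreadable if there is a permutation $\tau$ of $\{1,\ldots,nd\}$ with $\tau(j)\equiv j\pmod n$ for all $j$ such that the $K$-algebra isomorphism $\Phi:T_{nd}\to T_{nd}$, $\Phi(x_j)=x_{\tau(j)}$, satisfies $\Phi(\sigma^n(u))=u^p$ for all $u\in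 G(I)$. (For ideals of $T_{n'}$, replace $n$ by $n'$ everywhere, including in the polarization.) *)

theory Defs
  imports
    Complex_Main
    "HOL-Library.Multiset"
    "HOL-Library.Poly_Mapping"
    "HOL-Combinatorics.Permutations"
    "HOL-Number_Theory.Cong"
    "HOL-Algebra.Ideal"
    "HOL-Algebra.QuotRing"
begin

text \<open>
  A monomial \<open>x_{i_1} \<cdots> x_{i_d}\<close> is represented by the multiset of its variable indices
  \<open>{#i_1, \<dots>, i_d#}\<close>: multiplication is \<open>+\<close>, the monomial 1 is \<open>{#}\<close>, divisibility is
  \<open>\<subseteq>#\<close>, the degree is \<open>size\<close>, the exponent of \<open>x_j\<close> in \<open>u\<close> is \<open>count u j\<close> and the support is
  \<open>set_mset u\<close>. Polynomials are finitely supported functions from monomials to coefficients,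
  with the (convolution) ring structure from \<^theory>\<open>HOL-Library.Poly_Mapping\<close>.
  Variables are numbered from 1; the index 0 occurs in no ring \<open>T n\<close> below.
\<close>

type_synonym monomial = "nat multiset"
type_synonym 'k polynomial = "monomial \<Rightarrow>\<^sub>0 'k"

definition mpol :: "monomial \<Rightarrow> 'k::field polynomial" where
  "mpol u = Poly_Mapping.single u 1"

definition var :: "nat \<Rightarrow> 'k::field polynomial" where
  "var j = mpol {#j#}"

definition const :: "'k::field \<Rightarrow> 'k polynomial" where
  "const c = Poly_Mapping.single {#} c"

definition monomials :: "nat \<Rightarrow> monomial set" where
  "monomials n = {u. set_mset u \<subseteq> {1..n}}"

definition T :: "nat \<Rightarrow> 'k::field polynomial ring" where
  "T n = \<lparr>carrier = {p. Poly_Mapping.keys p \<subseteq> monomials n},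
          mult = (*), one = 1, zero = 0, add = (+)\<rparr>"

definition monomial_ideal :: "nat \<Rightarrow> 'k::field polynomial set \<Rightarrow> bool" where
  "monomial_ideal n I \<longleftrightarrow> (\<exists>M \<subseteq> monomials n. I = genideal (T n) (mpol ` M))"

text \<open>
  The minimal monomial generators of \<open>I\<close>: the monomials of \<open>I\<close> that are minimal with respect to
  divisibility. The lemmas \<open>genideal_min_gens\<close> and \<open>min_gens_subset\<close> below show that this is the
  smallest set of monomials generating \<open>I\<close>.
\<close>

definition min_gens :: "'k::field polynomial set \<Rightarrow> monomial set" where
  "min_gens I = {u. mpol u \<in> I \<and> (\<forall>w. mpol w \<in> I \<and> w \<subseteq># u \<longrightarrow> w = u)}"

text \<open>The maximum is over a finite set by lemma \<open>finite_min_gens\<close> below.\<close>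

definition ideal_deg :: "'k::field polynomial set \<Rightarrow> nat" where
  "ideal_deg I = Max (size ` min_gens I)"

definition sigma :: "monomial \<Rightarrow> monomial" where
  "sigma u = mset (map2 (+) (sorted_list_of_multiset u) [0..<size u])"

definition polarization :: "nat \<Rightarrow> monomial \<Rightarrow> monomial" where
  "polarization n u = (\<Sum>j = 1..n. \<Sum>k < count u j. {#k * n + j#})"

definition algebra_iso ::
  "'k::field polynomial ring \<Rightarrow> 'k polynomial ring \<Rightarrow> ('k polynomial \<Rightarrow> 'k polynomial) set" where
  "algebra_iso R S = {\<Phi> \<in> ring_iso R S. \<forall>c. \<Phi> (const c) = const c}"

definition smoothly_spreadable :: "nat \<Rightarrow> 'k::field polynomial set \<Rightarrow> bool" where
  "smoothly_spreadable n I \<longleftrightarrow> monomial_ideal n I \<and> I \<noteq> {0} \<and>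
    (let d = ideal_deg I in
      \<exists>\<tau>. \<tau> permutes {1..n * d} \<and> (\<forall>j \<in> {1..n * d}. [\<tau> j = j] (mod n)) \<and>
        (\<exists>\<Phi> \<in> algebra_iso (T (n * d) :: 'k polynomial ring) (T (n * d)).
          (\<forall>j \<in> {1..n * d}. \<Phi> (var j) = var (\<tau> j)) \<and>
          (\<forall>u \<in> min_gens I. \<Phi> (mpol ((sigma ^^ n) u)) = mpol (polarization n u))))"

lemma carrier_T: "p \<in> carrier (T n) \<longleftrightarrow> Poly_Mapping.keys p \<subseteq> monomials n"
  by (simp add: T_def)

lemma T_simps [simp]:
  "mult (T n) = (*)" "one (T n) = 1" "zero (T n) = 0" "add (T n) = (+)"
  by (simp_all add: T_def)

lemma keys_mpol [simp]: "Poly_Mapping.keys (mpol u :: 'k::field polynomial) = {u}"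
  by (simp add: mpol_def)

lemma mpol_in_T [simp]: "mpol u \<in> carrier (T n) \<longleftrightarrow> u \<in> monomials n"
  by (simp add: carrier_T)

lemma keys_mult_T:
  assumes "Poly_Mapping.keys p \<subseteq> monomials n" "Poly_Mapping.keys q \<subseteq> monomials n"
  shows "Poly_Mapping.keys (p * q :: 'k::field polynomial) \<subseteq> monomials n"
  using assms keys_mult[of p q] by (fastforce simp: monomials_def)

lemma cring_T: "cring (T n :: 'k::field polynomial ring)"
proof (rule cringI)
  show "abelian_group (T n :: 'k polynomial ring)"
  proof (rule abelian_groupI)
    fix x assume "x \<in> carrier (T n :: 'k polynomial ring)"
    then show "\<exists>y\<in>carrier (T n). y \<oplus>\<^bsub>T n\<^esub> x = \<zero>\<^bsub>T n\<^esub>"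
      by (intro bexI[of _ "- x"]) (auto simp: carrier_T)
  qed (auto simp: carrier_T add.assoc add.commute dest!: subsetD[OF Poly_Mapping.keys_add])
  show "comm_monoid (T n :: 'k polynomial ring)"
    by (rule comm_monoidI)
       (simp_all add: carrier_T ac_simps keys_mult_T, simp add: monomials_def)
qed (simp add: distrib_right)

lemma genideal_mpol:
  assumes M: "M \<subseteq> monomials n"
  shows "genideal (T n) (mpol ` M :: 'k::field polynomial set) =
    {p \<in> carrier (T n). \<forall>u \<in> Poly_Mapping.keys p. \<exists>w \<in> M. w \<subseteq># u}" (is "?L = ?R")
proof
  interpret cring "T n :: 'k polynomial ring" by (rule cring_T)
  have id: "ideal ?R (T n)"
  proof (rule idealI)
    show "subgroup ?R (add_monoid (T n))"
    proof (rule add.subgroupI)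
      show "?R \<noteq> {}" by (auto intro!: exI[of _ 0] simp: carrier_T)
    next
      fix a assume a: "a \<in> ?R"
      then have "- a \<oplus>\<^bsub>T n\<^esub> a = \<zero>\<^bsub>T n\<^esub>" "- a \<in> carrier (T n)" "a \<in> carrier (T n)"
        by (simp_all add: carrier_T)
      then have "\<ominus>\<^bsub>T n\<^esub> a = - a" by (intro minus_equality)
      with a show "\<ominus>\<^bsub>T n\<^esub> a \<in> ?R" by (simp add: carrier_T)
    next
      fix a b assume "a \<in> ?R" "b \<in> ?R"
      then show "a \<oplus>\<^bsub>T n\<^esub> b \<in> ?R"
        using Poly_Mapping.keys_add[of a b] by (auto simp: carrier_T)
    qed auto
  next
    fix a x assume a: "a \<in> ?R" and x: "x \<in> carrier (T n :: 'k polynomial ring)"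
    have "\<exists>w \<in> M. w \<subseteq># u" if "u \<in> Poly_Mapping.keys (x * a)" for u
    proof -
      from that keys_mult[of x a] obtain s t where u: "u = s + t" "t \<in> Poly_Mapping.keys a"
        by blast
      with a obtain w where "w \<in> M" "w \<subseteq># t" by blast
      moreover have "t \<subseteq># u" using u by simp
      ultimately show ?thesis using subset_mset.order_trans by blast
    qed
    with a x show "x \<otimes>\<^bsub>T n\<^esub> a \<in> ?R"
      by (simp add: carrier_T keys_mult_T)
    then show "a \<otimes>\<^bsub>T n\<^esub> x \<in> ?R" by (simp add: mult.commute)
  qed (rule ring_axioms)
  show "?L \<subseteq> ?R"
    by (rule genideal_minimal[OF id]) (use M in auto)
  show "?R \<subseteq> ?L"
  proof
    fix p assume p: "p \<in> ?R"
    have sub: "mpol ` M \<subseteq> carrier (T n :: 'k polynomial ring)" using M by auto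
    interpret L: ideal ?L "T n" by (rule genideal_ideal[OF sub])
    have mono: "Poly_Mapping.single u c \<in> ?L" if "u \<in> Poly_Mapping.keys p" for u c
    proof -
      from p that obtain w where w: "w \<in> M" "w \<subseteq># u" by blast
      have "u \<in> monomials n" using p that by (auto simp: carrier_T)
      then have "Poly_Mapping.single (u - w) c \<in> carrier (T n :: 'k polynomial ring)"
        by (auto simp: carrier_T monomials_def dest!: in_diffD)
      moreover have "mpol w \<in> ?L" using genideal_self[OF sub] w by auto
      ultimately have "Poly_Mapping.single (u - w) c \<otimes>\<^bsub>T n\<^esub> mpol w \<in> ?L"
        by (rule L.I_l_closed[rotated])
      with w show ?thesis by (simp add: mpol_def mult_single)
    qed
    have sums: "(\<Sum>u\<in>A. Poly_Mapping.single u (Poly_Mapping.lookup p u)) \<in> ?L"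
      if "finite A" "A \<subseteq> Poly_Mapping.keys p" for A
      using that
    proof (induction A rule: finite_induct)
      case empty
      then show ?case using L.zero_closed by simp
    next
      case (insert u A)
      then show ?case using L.a_closed[OF mono[of u]] by simp
    qed
    have "p = (\<Sum>u\<in>Poly_Mapping.keys p. Poly_Mapping.single u (Poly_Mapping.lookup p u))"
      by (rule poly_mapping_eqI) (simp add: lookup_sum lookup_single when_def in_keys_iff)
    then show "p \<in> ?L" using sums[of "Poly_Mapping.keys p"] by simp
  qed
qed

lemma mpol_in_genideal:
  assumes "M \<subseteq> monomials n"
  shows "(mpol u :: 'k::field polynomial) \<in> genideal (T n) (mpol ` M) \<longleftrightarrow>
    u \<in> monomials n \<and> (\<exists>w \<in> M. w \<subseteq># u)"
  by (simp add: genideal_mpol[OF assms])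

lemma min_gens_subset:
  assumes "M \<subseteq> monomials n" "I = genideal (T n) (mpol ` M)"
  shows "min_gens I \<subseteq> M"
  using assms by (fastforce simp: min_gens_def mpol_in_genideal)

lemma ex_min_gens:
  assumes "mpol u \<in> I"
  shows "\<exists>w \<in> min_gens I. w \<subseteq># u"
  using assms
proof (induction "size u" arbitrary: u rule: less_induct)
  case less
  show ?case
  proof (cases "u \<in> min_gens I")
    case False
    with less.prems obtain w where w: "mpol w \<in> I" "w \<subset># u"
      by (auto simp: min_gens_def subset_mset.le_less)
    from w(2) have "size w < size u" by (rule mset_subset_size)
    from less.hyps[OF this w(1)] obtain x where "x \<in> min_gens I" "x \<subseteq># w" by blast
    moreover from w(2) have "w \<subseteq># u" by (rule subset_mset.less_imp_le)
    ultimately show ?thesis using subset_mset.order_trans by blast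
  qed auto
qed

lemma genideal_min_gens:
  assumes "monomial_ideal n I"
  shows "min_gens I \<subseteq> monomials n" "genideal (T n) (mpol ` min_gens I) = I"
proof -
  from assms obtain M where M: "M \<subseteq> monomials n" "I = genideal (T n) (mpol ` M)"
    by (auto simp: monomial_ideal_def)
  show 1: "min_gens I \<subseteq> monomials n" using min_gens_subset[OF M] M(1) by blast
  have "(\<exists>w \<in> M. w \<subseteq># u) \<longleftrightarrow> (\<exists>w \<in> min_gens I. w \<subseteq># u)" for u
  proof
    assume "\<exists>w \<in> M. w \<subseteq># u"
    then obtain w where w: "w \<in> M" "w \<subseteq># u" by blast
    then have "mpol w \<in> I" using M by (auto simp: mpol_in_genideal)
    then show "\<exists>w \<in> min_gens I. w \<subseteq># u"
      using ex_min_gens[of w I] w(2) subset_mset.order_trans by blast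
  qed (use min_gens_subset[OF M] in blast)
  then have "genideal (T n) (mpol ` min_gens I) = genideal (T n) (mpol ` M)"
    unfolding genideal_mpol[OF 1] genideal_mpol[OF M(1)] by simp
  with M(2) show "genideal (T n) (mpol ` min_gens I) = I" by simp
qed

lemma nat_seq_mono_subseq:
  fixes s :: "nat \<Rightarrow> nat"
  shows "\<exists>r :: nat \<Rightarrow> nat. strict_mono r \<and> mono (s \<circ> r)"
proof -
  obtain r where r: "strict_mono r" "monoseq (\<lambda>n. s (r n))"
    using seq_monosub by blast
  show ?thesis
  proof (cases "incseq (\<lambda>n. s (r n))")
    case True
    with r show ?thesis by (intro exI[of _ r]) (simp add: o_def)
  next
    case False
    with r(2) have dec: "decseq (\<lambda>n. s (r n))" by (simp add: monoseq_iff)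
    obtain N where N: "\<And>n. s (r N) \<le> s (r n)"
      using ex_has_least_nat[of "\<lambda>_. True" _ "\<lambda>n. s (r n)"] by auto
    have "s (r (N + n)) = s (r N)" for n
      using N[of "N + n"] decseqD[OF dec, of N "N + n"] by simp
    then have "mono (s \<circ> (\<lambda>n. r (N + n)))" by (simp add: mono_def)
    moreover have "strict_mono (\<lambda>n. r (N + n))" using r(1) by (simp add: strict_mono_def)
    ultimately show ?thesis by blast
  qed
qed

lemma mono_count_subseq:
  fixes f :: "nat \<Rightarrow> monomial"
  assumes "finite A"
  shows "\<exists>r :: nat \<Rightarrow> nat. strict_mono r \<and> (\<forall>a \<in> A. mono (\<lambda>i. count (f (r i)) a))"
  using assms
proof (induction A rule: finite_induct)
  case empty
  have "strict_mono (id :: nat \<Rightarrow> nat)" by (simp add: strict_mono_def)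
  then show ?case by blast
next
  case (insert a A)
  then obtain r :: "nat \<Rightarrow> nat" where r: "strict_mono r" "\<forall>a \<in> A. mono (\<lambda>i. count (f (r i)) a)" by blast
  obtain q :: "nat \<Rightarrow> nat" where q: "strict_mono q" "mono ((\<lambda>i. count (f (r i)) a) \<circ> q)"
    using nat_seq_mono_subseq by blast
  have "strict_mono (r \<circ> q)" using r(1) q(1) by (rule strict_mono_o)
  moreover have "mono (\<lambda>i. count (f ((r \<circ> q) i)) b)" if "b \<in> insert a A" for b
    using that q r(2) by (auto simp: mono_def o_def strict_mono_less_eq)
  ultimately show ?case by blast
qed

lemma finite_min_gens:
  assumes "monomial_ideal n I"
  shows "finite (min_gens I)"
proof (rule ccontr)
  assume "infinite (min_gens I)"
  then obtain f :: "nat \<Rightarrow> monomial" where f: "inj f" "range f \<subseteq> min_gens I"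
    using infinite_countable_subset by blast
  obtain r :: "nat \<Rightarrow> nat" where r: "strict_mono r" "\<forall>a \<in> {1..n}. mono (\<lambda>i. count (f (r i)) a)"
    using mono_count_subseq[of "{1..n}" f] by auto
  have "f (r 0) \<subseteq># f (r 1)"
  proof (rule mset_subset_eqI)
    fix a
    show "count (f (r 0)) a \<le> count (f (r 1)) a"
    proof (cases "a \<in> {1..n}")
      case True
      with r(2) show ?thesis by (auto simp: mono_def)
    next
      case False
      have "f (r 0) \<in> monomials n" using f(2) genideal_min_gens(1)[OF assms] by blast
      with False have "a \<notin># f (r 0)" by (auto simp: monomials_def)
      then show ?thesis by (simp add: not_in_iff)
    qed
  qed
  moreover have "f (r 0) \<in> min_gens I" "f (r 1) \<in> min_gens I" using f(2) by blast+
  ultimately have "f (r 0) = f (r 1)" by (auto simp: min_gens_def)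
  then have "r 0 = r 1" using f(1) by (simp add: inj_eq)
  with r(1) show False by (simp add: strict_mono_eq)
qed

end

theory Submission
  imports Defs
begin

text \<open>
  Write an index in \<open>{1..n * d}\<close> uniquely as \<open>k * n + j\<close> with \<open>j \<in> {1..n}\<close> and \<open>k < d\<close>; call \<open>j\<close> its class
  and \<open>k\<close> its level. A permutation that preserves residues modulo \<open>n\<close> is the same thing as a family of
  permutations of the levels \<open>{..<d}\<close>, one for each class.

  If \<open>u\<close> is written as an increasing word of variables, the letters \<open>x_j\<close> occupy an interval of
  places, \<open>block u j\<close>. Applying \<open>sigma\<close> \<open>n\<close> times adds \<open>n\<close> times the place to each index, so the result is the
  squarefree monomial whose levels in class \<open>j\<close> are \<open>block u j\<close>. The polarization is the squarefree
  monomial whose levels in class \<open>j\<close> are \<open>{..<count u j}\<close>. An algebra map that permutes the variables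
  therefore sends one to the other exactly if, for each \<open>j\<close>, the level permutation of class \<open>j\<close> carries
  \<open>block u j\<close> onto \<open>{..<count u j}\<close>.

  Only the restriction of a level permutation to the union of the blocks matters. The blocks and their images lie
  in \<open>{..<d}\<close>, and an injection between subsets of a finite set extends to a permutation of that set.
  So being smoothly spreadable amounts to a condition on the minimal generators in which neither \<open>n\<close>
  nor the degree occurs: for every \<open>j\<close> there is a map, injective on the union of the blocks, which carries each
  \<open>block u j\<close> onto \<open>{..<count u j}\<close>. This is \<open>smoothly_spreadable_iff_straightenable\<close>.

  The theorem follows. Unless \<open>I\<close> is the unit ideal (and then so is \<open>J\<close>), the minimal generators of
  \<open>J\<close> are those of \<open>I\<close> together with \<open>v\<close>. Since \<open>v\<close> shares no variable with the generators of \<open>I\<close>, each \<open>j\<close>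
  is concerned either with \<open>v\<close> alone, where a shift of the block of \<open>v\<close> to \<open>0\<close> does the job, or with \<open>I\<close> alone.
\<close>

section \<open>Blocks and levels\<close>


text \<open>
  The places, counted from 0, that the letter \<open>j\<close> occupies in the increasing word of \<open>u\<close>.
\<close>

definition block :: "monomial \<Rightarrow> nat \<Rightarrow> nat set" where
  "block u j = {size {#i \<in># u. i < j#} ..< size {#i \<in># u. i < j#} + count u j}"

text \<open>
  Injectivity is required on the union of the blocks, not on each of them: one map must serve all
  monomials of \<open>G\<close> and must be the restriction of a single permutation of levels.
\<close>

definition straightens :: "(nat \<Rightarrow> nat) \<Rightarrow> monomial set \<Rightarrow> nat \<Rightarrow> bool" where
  "straightens f G j \<longleftrightarrow> inj_on f (\<Union>u\<in>G. block u j) \<and>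
     (\<forall>u\<in>G. f ` block u j = {..<count u j})"

definition straightenable :: "monomial set \<Rightarrow> bool" where
  "straightenable G \<longleftrightarrow> (\<forall>j. \<exists>f. straightens f G j)"

text \<open>Squarefree monomials are handled as sets of indices; \<open>L j\<close> collects the levels that occur in class \<open>j\<close>.\<close>

definition positions :: "nat \<Rightarrow> (nat \<Rightarrow> nat set) \<Rightarrow> nat set" where
  "positions n L = {k * n + j |j k. k \<in> L j}"

lemma monomials_memD: "u \<in> monomials n \<Longrightarrow> j \<in># u \<Longrightarrow> j \<in> {1..n}"
  unfolding monomials_def by blast

lemma block_empty [simp]: "j \<notin># u \<Longrightarrow> block u j = {}"
  by (simp add: block_def not_in_iff)

lemma block_bound: "block u j \<subseteq> {..<size u}"
proof -
  have "size {#i \<in># u. i < j#} + count u j \<le> size u"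
    by (induction u) auto
  then show ?thesis by (auto simp: block_def)
qed

lemma finite_positions:
  assumes "finite A" "\<And>j. finite (L j)" "\<And>j. j \<notin> A \<Longrightarrow> L j = {}"
  shows "finite (positions n L)"
proof -
  have "positions n L = (\<Union>j\<in>A. (\<lambda>k. k * n + j) ` L j)"
    using assms(3) by (fastforce simp: positions_def)
  then show ?thesis using assms(1,2) by simp
qed

section \<open>Iterated shifts and polarizations as sets of indices\<close>

lemma nth_eq_iff_block:
  assumes "sorted xs" "k < length xs"
  shows "xs ! k = j \<longleftrightarrow> k \<in> block (mset xs) j"
  using assms
proof (induction xs arbitrary: k)
  case (Cons x xs)
  have none: "{#i \<in># mset xs. i < j#} = {#}" if "j \<le> x"
    using that Cons.prems(1) by (auto simp: filter_mset_eq_conv not_less intro: order_trans)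
  have absent: "count (mset xs) j = 0" if "j < x"
    using that Cons.prems(1) by (fastforce simp: count_eq_zero_iff)
  show ?case
  proof (cases k)
    case 0
    then show ?thesis using none absent
      by (cases x j rule: linorder_cases) (auto simp: block_def)
  next
    case (Suc k')
    then have IH: "xs ! k' = j \<longleftrightarrow> k' \<in> block (mset xs) j" using Cons by simp
    show ?thesis
    proof (cases x j rule: linorder_cases)
      case equal
      then have empty: "{#i \<in># mset xs. i < j#} = {#}" "{#i \<in># mset (x # xs). i < j#} = {#}"
        using none by simp_all
      show ?thesis using equal IH Suc unfolding block_def empty by simp
    qed (use IH Suc none absent in \<open>auto simp: block_def\<close>)
  qed
qed simp

lemma sigma_pow_sorted:
  assumes "sorted xs"
  shows "(sigma ^^ t) (mset xs) = mset (map (\<lambda>k. k * t + xs ! k) [0..<length xs])"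
proof (induction t)
  case 0
  then show ?case by (simp add: map_nth)
next
  case (Suc t)
  let ?ys = "map (\<lambda>k. k * t + xs ! k) [0..<length xs]"
  have "sorted ?ys"
    using assms by (auto simp: sorted_iff_nth_mono intro!: add_mono)
  then have "sorted_list_of_multiset (mset ?ys) = ?ys"
    by (simp only: sorted_list_of_multiset_mset sort_key_id_if_sorted sorted_sort_id)
  moreover have "size (mset ?ys) = length xs" by simp
  ultimately have "sigma (mset ?ys) = mset (map2 (+) ?ys [0..<length xs])"
    by (simp only: sigma_def)
  also have "map2 (+) ?ys [0..<length xs] = map (\<lambda>k. k * Suc t + xs ! k) [0..<length xs]"
    by (rule nth_equalityI) auto
  finally show ?case using Suc by simp
qed

text \<open>
  The letter at place \<open>k\<close> of the increasing word is \<open>j\<close> exactly if \<open>k\<close> lies in the block of \<open>j\<close>, and it moves to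
  \<open>k * t + j\<close>. For positive \<open>t\<close> these indices increase strictly with \<open>k\<close>, so the result is squarefree.
\<close>

lemma sigma_pow_eq_positions:
  assumes "0 < t"
  shows "(sigma ^^ t) u = mset_set (positions t (block u))"
proof -
  define xs where "xs = sorted_list_of_multiset u"
  have xs: "sorted xs" "mset xs = u" by (simp_all add: xs_def)
  let ?p = "\<lambda>k. k * t + xs ! k"
  have "?p k < ?p l" if "k < l" "l < length xs" for k l
    using that assms xs(1) by (intro add_less_le_mono) (auto simp: sorted_iff_nth_mono)
  then have inj: "inj_on ?p {0..<length xs}"
    by (intro linorder_inj_onI) (fastforce simp: less_imp_neq)+
  have "(sigma ^^ t) u = image_mset ?p (mset_set {0..<length xs})"
    using sigma_pow_sorted[OF xs(1), of t] xs(2) by simp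
  also have "\<dots> = mset_set (?p ` {0..<length xs})"
    by (rule image_mset_mset_set[OF inj])
  also have "?p ` {0..<length xs} = positions t (block u)"
  proof
    show "?p ` {0..<length xs} \<subseteq> positions t (block u)"
      using nth_eq_iff_block[OF xs(1)] xs(2) unfolding positions_def by fastforce
    show "positions t (block u) \<subseteq> ?p ` {0..<length xs}"
    proof
      fix i assume "i \<in> positions t (block u)"
      then obtain j k where i: "i = k * t + j" "k \<in> block u j" by (auto simp: positions_def)
      have k: "k < length xs" using i(2) block_bound[of u j] xs(2) by (metis lessThan_iff size_mset subsetD)
      with i nth_eq_iff_block[OF xs(1) k, of j] xs(2) show "i \<in> ?p ` {0..<length xs}" by auto
    qed
  qed
  finally show ?thesis .
qed

lemma position_eq_iff:
  fixes n :: nat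
  assumes "j \<in> {1..n}" "j' \<in> {1..n}"
  shows "k * n + j = k' * n + j' \<longleftrightarrow> k = k' \<and> j = j'"
proof
  assume eq: "k * n + j = k' * n + j'"
  have level: "(l * n + i - 1) div n = l" if "i \<in> {1..n}" for l i
  proof -
    have "l * n + i - 1 = (i - 1) + l * n" using that by auto
    moreover have "((i - 1) + l * n) div n = l" using that by (subst div_mult_self1) auto
    ultimately show ?thesis by simp
  qed
  have "k = k'" using level[OF assms(1), of k] level[OF assms(2), of k'] eq by simp
  with eq show "k = k' \<and> j = j'" by simp
qed simp

text \<open>
  The bound on the variables of \<open>u\<close> matters: the polarization only sees the exponents of the
  variables \<open>1, \<dots>, n\<close>, while \<open>positions\<close> ranges over all of them.
\<close>

lemma polarization_eq_positions:
  assumes "u \<in> monomials n"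
  shows "polarization n u = mset_set (positions n (\<lambda>j. {..<count u j}))"
proof -
  let ?A = "SIGMA j:{1..n}. {..<count u j}"
  have single: "(\<Sum>x\<in>A. {#f x#}) = image_mset f (mset_set A)" if "finite A"
    for f :: "nat \<times> nat \<Rightarrow> nat" and A
    using that by (induction A rule: finite_induct) auto
  have inj: "inj_on (\<lambda>(j, k). k * n + j) ?A"
    by (rule inj_onI) (auto simp: position_eq_iff simp del: atLeastAtMost_iff)
  have "polarization n u = (\<Sum>x\<in>?A. {#(\<lambda>(j, k). k * n + j) x#})"
    by (simp add: polarization_def sum.Sigma split_def)
  also have "\<dots> = mset_set ((\<lambda>(j, k). k * n + j) ` ?A)"
    by (simp only: single finite_SigmaI finite_atLeastAtMost finite_lessThan image_mset_mset_set[OF inj])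
  also have "(\<lambda>(j, k). k * n + j) ` ?A = positions n (\<lambda>j. {..<count u j})"
  proof -
    have "j \<in> {1..n}" if "k < count u j" for j k
    proof -
      have "j \<in># u" using that by (metis count_greater_zero_iff gr_zeroI not_less0)
      then show ?thesis using assms by (auto simp: monomials_def)
    qed
    then show ?thesis by (force simp: positions_def image_iff)
  qed
  finally show ?thesis .
qed

section \<open>Permutations that preserve residue classes\<close>

text \<open>
  A map that acts on each class through its levels can be compared class by class, because class
  and level are determined by the index.
\<close>

lemma image_positions_eq_iff:
  assumes step: "\<And>j k. j \<in> {1..n} \<Longrightarrow> k < d \<Longrightarrow> \<tau> (k * n + j) = g j k * n + j"
    and L: "\<And>j. L j \<subseteq> {..<d}" "\<And>j. j \<notin> {1..n} \<Longrightarrow> L j = {}"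
    and L': "\<And>j. j \<notin> {1..n} \<Longrightarrow> L' j = {}"
  shows "\<tau> ` positions n L = positions n L' \<longleftrightarrow> (\<forall>j. g j ` L j = L' j)"
proof -
  have mem: "k * n + j \<in> positions n M \<longleftrightarrow> k \<in> M j"
    if "j \<in> {1..n}" "\<And>j. j \<notin> {1..n} \<Longrightarrow> M j = {}" for j k M
  proof
    assume "k * n + j \<in> positions n M"
    then obtain j' k' where eq: "k * n + j = k' * n + j'" "k' \<in> M j'"
      by (auto simp: positions_def)
    with that(2) have "j' \<in> {1..n}" by blast
    then have "k = k' \<and> j = j'" using eq(1) by (simp only: position_eq_iff[OF that(1)])
    with eq(2) show "k \<in> M j" by simp
  qed (auto simp: positions_def)
  have image: "\<tau> ` positions n L = positions n (\<lambda>j. g j ` L j)"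
  proof -
    have "\<tau> (k * n + j) = g j k * n + j" if "k \<in> L j" for j k
      using that L step by blast
    then show ?thesis by (fastforce simp: positions_def image_iff)
  qed
  show ?thesis
  proof
    assume eq: "\<tau> ` positions n L = positions n L'"
    show "\<forall>j. g j ` L j = L' j"
    proof
      fix j
      show "g j ` L j = L' j"
      proof (cases "j \<in> {1..n}")
        case True
        have "k \<in> g j ` L j \<longleftrightarrow> k \<in> L' j" for k
          using mem[OF True, of "\<lambda>j. g j ` L j" k] mem[OF True, of L' k] L(2) L' eq image by simp
        then show ?thesis by blast
      next
        case False
        with L(2) L' show ?thesis by simp
      qed
    qed
  next
    assume "\<forall>j. g j ` L j = L' j"
    with image show "\<tau> ` positions n L = positions n L'" by simp
  qed
qed

lemma position_in_range:
  fixes n d j k :: nat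
  assumes "j \<in> {1..n}" "k < d"
  shows "k * n + j \<in> {1..n * d}"
proof -
  have "k * n + j \<le> k * n + n" using assms by simp
  also have "\<dots> = Suc k * n" by simp
  also have "\<dots> \<le> d * n" using assms by (intro mult_right_mono) auto
  finally show ?thesis using assms by (simp add: mult.commute)
qed

lemma position_cases:
  fixes n d i :: nat
  assumes "i \<in> {1..n * d}"
  obtains j k where "j \<in> {1..n}" "k < d" "i = k * n + j"
proof (rule that[of "(i - 1) mod n + 1" "(i - 1) div n"])
  have n: "0 < n" using assms by (cases n) auto
  then show "(i - 1) mod n + 1 \<in> {1..n}" by (simp add: Suc_le_eq)
  have "i - 1 < d * n" using assms by (auto simp: mult.commute)
  then show "(i - 1) div n < d" using n by (simp add: div_less_iff_less_mult)
  show "i = (i - 1) div n * n + ((i - 1) mod n + 1)"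
    using assms div_mult_mod_eq[of "i - 1" n] by simp
qed

text \<open>
  The image of an index is again in \<open>{1..n * d}\<close> and has the same residue. The classes \<open>1, \<dots>, n\<close> are
  pairwise incongruent, so the class stays the same and only the level moves.
\<close>

lemma class_preserving_acts_on_levels:
  fixes n d :: nat
  assumes "\<tau> permutes {1..n * d}" "\<forall>i \<in> {1..n * d}. [\<tau> i = i] (mod n)"
  shows "\<exists>g. \<forall>j \<in> {1..n}. inj_on (g j) {..<d} \<and> (\<forall>k<d. \<tau> (k * n + j) = g j k * n + j)"
proof -
  have "\<exists>l. \<tau> (k * n + j) = l * n + j" if j: "j \<in> {1..n}" and k: "k < d" for j k
  proof -
    have "\<tau> (k * n + j) \<in> {1..n * d}"
      using position_in_range[OF j k] permutes_in_image[OF assms(1)] by blast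
    then obtain j' l where l: "j' \<in> {1..n}" "\<tau> (k * n + j) = l * n + j'"
      using position_cases by blast
    have "[l * n + j' = k * n + j] (mod n)"
      using assms(2) position_in_range[OF j k] l(2) by metis
    then have c: "[j' = j] (mod n)" by (simp add: cong_def)
    (* Two distinct elements of {1..n} differ by less than n, so n cannot divide their difference. *)
    have "j' = j"
    proof (rule ccontr)
      assume ne: "j' \<noteq> j"
      have "int n dvd int j' - int j"
        using c by (metis cong_iff_dvd_diff cong_int_iff)
      then have "int n \<le> \<bar>int j' - int j\<bar>"
        using ne by (metis dvd_imp_le_int abs_of_nat right_minus_eq of_nat_eq_iff)
      then show False using j l(1) by auto
    qed
    with l show ?thesis by blast
  qed
  then obtain g where g: "\<And>j k. j \<in> {1..n} \<Longrightarrow> k < d \<Longrightarrow> \<tau> (k * n + j) = g j k * n + j"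
    by metis
  moreover have "inj_on (g j) {..<d}" if j: "j \<in> {1..n}" for j
  proof (rule inj_onI)
    fix k k' assume kk: "k \<in> {..<d}" "k' \<in> {..<d}" "g j k = g j k'"
    then have "\<tau> (k * n + j) = \<tau> (k' * n + j)" using g[OF j] by simp
    then have "k * n + j = k' * n + j" using permutes_inj[OF assms(1)] by (simp add: inj_eq)
    then show "k = k'" by (simp only: position_eq_iff[OF j j])
  qed
  ultimately show ?thesis by blast
qed

lemma level_permutations_lift:
  fixes n d :: nat
  assumes "\<And>j. g j permutes {..<d}"
  shows "\<exists>\<tau>. \<tau> permutes {1..n * d} \<and> (\<forall>i \<in> {1..n * d}. [\<tau> i = i] (mod n)) \<and>
    (\<forall>j \<in> {1..n}. \<forall>k<d. \<tau> (k * n + j) = g j k * n + j)"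
proof -
  (* Subtracting 1 before dividing makes the residues run over 1, ..., n instead of 0, ..., n - 1. *)
  define \<tau> where "\<tau> i = (if i \<in> {1..n * d}
    then g ((i - 1) mod n + 1) ((i - 1) div n) * n + ((i - 1) mod n + 1) else i)" for i
  have val: "\<tau> (k * n + j) = g j k * n + j" if j: "j \<in> {1..n}" and k: "k < d" for j k
  proof -
    have n: "0 < n" using j by simp
    have e: "k * n + j - 1 = (j - 1) + k * n" using j by simp
    have "(k * n + j - 1) div n = k" unfolding e using n j by (subst div_mult_self1) auto
    moreover have "(k * n + j - 1) mod n = j - 1" unfolding e using j by (subst mod_mult_self1) auto
    ultimately show ?thesis using position_in_range[OF j k] j by (simp add: \<tau>_def)
  qed
  have into: "g j k < d" if "k < d" for j k
    using permutes_in_image[OF assms, of j k] that by simp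
  have "inj_on \<tau> {1..n * d}"
  proof (rule inj_onI)
    fix a b assume ab: "a \<in> {1..n * d}" "b \<in> {1..n * d}" "\<tau> a = \<tau> b"
    obtain j k where a: "j \<in> {1..n}" "k < d" "a = k * n + j" using ab(1) by (rule position_cases)
    obtain j' k' where b: "j' \<in> {1..n}" "k' < d" "b = k' * n + j'" using ab(2) by (rule position_cases)
    have "g j k * n + j = g j' k' * n + j'" using ab(3) a b val by simp
    then have "g j k = g j' k' \<and> j = j'" by (rule position_eq_iff[OF a(1) b(1), THEN iffD1])
    then have eq: "g j' k = g j' k'" "j = j'" by auto
    then have "k = k'" using permutes_inj[OF assms] by (simp add: inj_eq)
    then show "a = b" using a(3) b(3) eq(2) by simp
  qed
  moreover have "\<tau> ` {1..n * d} \<subseteq> {1..n * d}"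
  proof (rule image_subsetI)
    fix i assume "i \<in> {1..n * d}"
    then obtain j k where "j \<in> {1..n}" "k < d" "i = k * n + j" by (rule position_cases)
    then show "\<tau> i \<in> {1..n * d}" using val into position_in_range by presburger
  qed
  ultimately have "bij_betw \<tau> {1..n * d} {1..n * d}"
    by (simp add: bij_betw_def endo_inj_surj)
  then have "\<tau> permutes {1..n * d}"
    by (rule bij_imp_permutes) (simp only: \<tau>_def if_False)
  moreover have "[\<tau> i = i] (mod n)" if i: "i \<in> {1..n * d}" for i
    using i by (rule position_cases) (simp add: val cong_def del: atLeastAtMost_iff)
  ultimately show ?thesis using val by blast
qed

text \<open>
  Domain and image of the injection have the same cardinality, hence so do their complements in \<open>A\<close>,
  and any bijection between the complements fills the gap.
\<close>

lemma inj_on_extends_to_permutation: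
  assumes "finite A" "U \<subseteq> A" "f ` U \<subseteq> A" "inj_on f U"
  shows "\<exists>g. g permutes A \<and> (\<forall>x\<in>U. g x = f x)"
proof -
  have fin: "finite U" using assms finite_subset by blast
  have "card (A - U) = card (A - f ` U)"
    using assms fin by (simp add: card_Diff_subset card_image)
  then obtain h where h: "bij_betw h (A - U) (A - f ` U)"
    using assms(1) finite_same_card_bij by blast
  define g where "g x = (if x \<in> U then f x else if x \<in> A then h x else x)" for x
  have "bij_betw g U (f ` U)"
    using assms(4) by (subst bij_betw_cong[of _ _ f]) (auto simp: g_def bij_betw_def)
  moreover have "bij_betw g (A - U) (A - f ` U)"
    using h by (subst bij_betw_cong[of _ _ h]) (auto simp: g_def)
  ultimately have "bij_betw g (U \<union> (A - U)) (f ` U \<union> (A - f ` U))"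
    by (rule bij_betw_combine) blast
  moreover have "U \<union> (A - U) = A" "f ` U \<union> (A - f ` U) = A" using assms by auto
  ultimately have "bij_betw g A A" by simp
  then have "g permutes A"
    using assms(2) by (rule_tac bij_imp_permutes) (auto simp: g_def)
  then show ?thesis by (auto simp: g_def)
qed

section \<open>A criterion that involves neither the number of variables nor the degree\<close>

text \<open>
  The bound on the degrees serves both directions: it puts every block in the range where a given
  permutation acts on levels, and it keeps blocks and images in \<open>{..<d}\<close>, so that a straightening map
  extends to a permutation of the levels.
\<close>

lemma class_preserving_iff_straightenable:
  assumes n: "1 \<le> n" and G: "G \<subseteq> monomials n" "\<And>u. u \<in> G \<Longrightarrow> size u \<le> d"
  shows "(\<exists>\<tau>. \<tau> permutes {1..n * d} \<and> (\<forall>i \<in> {1..n * d}. [\<tau> i = i] (mod n)) \<and>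
      (\<forall>u\<in>G. image_mset \<tau> ((sigma ^^ n) u) = polarization n u)) \<longleftrightarrow> straightenable G"
    (is "?L \<longleftrightarrow> ?R")
proof -
  have notin: "j \<notin># u" if "u \<in> G" "j \<notin> {1..n}" for u j
    using that G(1) monomials_memD by blast
  have bound: "block u j \<subseteq> {..<d}" if "u \<in> G" for u j
    using block_bound[of u j] G(2)[OF that] by auto
  have count_bound: "count u j \<le> d" if "u \<in> G" for u j
    using count_le_size[of u j] G(2)[OF that] by linarith
  have levels: "image_mset \<tau> ((sigma ^^ n) u) = polarization n u \<longleftrightarrow>
      (\<forall>j. g j ` block u j = {..<count u j})"
    if u: "u \<in> G" and \<tau>: "\<tau> permutes {1..n * d}"
      and g: "\<forall>j \<in> {1..n}. \<forall>k<d. \<tau> (k * n + j) = g j k * n + j" for u \<tau> g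
  proof -
    have fin: "finite (positions n (block u))" "finite (positions n (\<lambda>j. {..<count u j}))"
      by (rule finite_positions[of "set_mset u"]; simp add: block_def not_in_iff)+
    have "image_mset \<tau> ((sigma ^^ n) u) = mset_set (\<tau> ` positions n (block u))"
      using n permutes_inj_on[OF \<tau>] by (simp add: sigma_pow_eq_positions image_mset_mset_set)
    moreover have "polarization n u = mset_set (positions n (\<lambda>j. {..<count u j}))"
      using u G(1) by (intro polarization_eq_positions) auto
    ultimately have "image_mset \<tau> ((sigma ^^ n) u) = polarization n u \<longleftrightarrow>
        \<tau> ` positions n (block u) = positions n (\<lambda>j. {..<count u j})"
      using fin by (simp add: mset_set_eq_iff)
    also have "\<dots> \<longleftrightarrow> (\<forall>j. g j ` block u j = {..<count u j})"
      using g bound[OF u] notin[OF u]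
      by (intro image_positions_eq_iff[where d = d]) (auto simp: not_in_iff)
    finally show ?thesis .
  qed
  show ?thesis
  proof
    assume ?L
    then obtain \<tau> where \<tau>: "\<tau> permutes {1..n * d}" "\<forall>i \<in> {1..n * d}. [\<tau> i = i] (mod n)"
      "\<forall>u\<in>G. image_mset \<tau> ((sigma ^^ n) u) = polarization n u" by blast
    obtain g where g: "\<forall>j \<in> {1..n}. inj_on (g j) {..<d} \<and> (\<forall>k<d. \<tau> (k * n + j) = g j k * n + j)"
      using class_preserving_acts_on_levels[OF \<tau>(1,2)] by blast
    show ?R unfolding straightenable_def
    proof
      fix j
      have "inj_on (g j) (\<Union>u\<in>G. block u j)"
      proof (cases "j \<in> {1..n}")
        case True
        then have "inj_on (g j) {..<d}" using g by blast
        then show ?thesis by (rule inj_on_subset) (rule UN_least, rule bound)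
      next
        case False
        then have "(\<Union>u\<in>G. block u j) = {}" using notin by simp
        then show ?thesis by (simp only: inj_on_empty)
      qed
      moreover have "\<forall>u\<in>G. g j ` block u j = {..<count u j}"
        using levels[OF _ \<tau>(1), of _ g] g \<tau>(3) by simp
      ultimately have "straightens (g j) G j" by (simp only: straightens_def simp_thms)
      then show "\<exists>f. straightens f G j" by (rule exI[of _ "g j"])
    qed
  next
    assume ?R
    have "\<exists>h. h permutes {..<d} \<and> (\<forall>u\<in>G. h ` block u j = {..<count u j})" for j
    proof -
      obtain f where "straightens f G j" using \<open>?R\<close> unfolding straightenable_def by blast
      then have f: "inj_on f (\<Union>u\<in>G. block u j)" "\<And>u. u \<in> G \<Longrightarrow> f ` block u j = {..<count u j}"
        by (simp_all only: straightens_def)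
      have image: "f ` (\<Union>u\<in>G. block u j) \<subseteq> {..<d}"
        unfolding image_UN by (rule UN_least) (simp add: f(2) count_bound)
      have "(\<Union>u\<in>G. block u j) \<subseteq> {..<d}" by (rule UN_least) (rule bound)
      from inj_on_extends_to_permutation[OF finite_lessThan this image f(1)]
      obtain h where h: "h permutes {..<d}" "\<forall>x\<in>(\<Union>u\<in>G. block u j). h x = f x" by blast
      have "h ` block u j = {..<count u j}" if "u \<in> G" for u
      proof -
        have "h ` block u j = f ` block u j" using h(2) that by (intro image_cong) auto
        then show ?thesis using f(2)[OF that] by simp
      qed
      with h(1) show ?thesis by blast
    qed
    then obtain g where g: "\<And>j. g j permutes {..<d}"
      "\<And>j u. u \<in> G \<Longrightarrow> g j ` block u j = {..<count u j}" by metis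
    obtain \<tau> where \<tau>: "\<tau> permutes {1..n * d}" "\<forall>i \<in> {1..n * d}. [\<tau> i = i] (mod n)"
      "\<forall>j \<in> {1..n}. \<forall>k<d. \<tau> (k * n + j) = g j k * n + j"
      using level_permutations_lift[of g d n] g(1) by blast
    have "image_mset \<tau> ((sigma ^^ n) u) = polarization n u" if "u \<in> G" for u
      using levels[OF that \<tau>(1,3)] g(2)[OF that] by blast
    with \<tau> show ?L by blast
  qed
qed

section \<open>Algebra automorphisms that permute the variables\<close>

lemma mpol_eq_iff: "(mpol u :: 'k::field polynomial) = mpol w \<longleftrightarrow> u = w"
proof
  assume "(mpol u :: 'k polynomial) = mpol w"
  then have "Poly_Mapping.keys (mpol u :: 'k polynomial) = Poly_Mapping.keys (mpol w :: 'k polynomial)"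
    by (rule arg_cong)
  then show "u = w" by simp
qed simp

lemma ring_hom_mpol:
  fixes \<Phi> :: "'k::field polynomial \<Rightarrow> 'k polynomial"
  assumes hom: "\<Phi> \<in> ring_hom (T m) (T m)"
    and var: "\<forall>j \<in> {1..m}. \<Phi> (var j) = var (\<tau> j)"
    and w: "w \<in> monomials m"
  shows "\<Phi> (mpol w) = mpol (image_mset \<tau> w)"
  using w
proof (induction w)
  case empty
  have "mpol {#} = (1 :: 'k polynomial)"
    by (simp add: mpol_def flip: zero_multiset_def)
  then show ?case using ring_hom_one[OF hom] by simp
next
  case (add j w)
  have split: "mpol (add_mset i u) = (var i :: 'k polynomial) * mpol u" for i u
    by (simp add: var_def mpol_def mult_single)
  have j: "j \<in> {1..m}" and w: "w \<in> monomials m" using add.prems by (auto simp: monomials_def)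
  have "\<Phi> (var j * mpol w) = \<Phi> (var j) * \<Phi> (mpol w)"
    using ring_hom_mult[OF hom, of "var j" "mpol w"] j w by (simp add: var_def monomials_def)
  then show ?case using add.IH[OF w] j var by (simp add: split)
qed

text \<open>
  \<open>map_key\<close> pulls coefficients back along a map of monomials, hence the inverse: the coefficient of \<open>u\<close>
  in the renamed polynomial is that of the monomial which is renamed to \<open>u\<close>. This is the substitution of
  \<open>x_{\<tau> j}\<close> for \<open>x_j\<close> when \<open>\<tau>\<close> is a bijection.
\<close>

definition rename :: "(nat \<Rightarrow> nat) \<Rightarrow> 'k::field polynomial \<Rightarrow> 'k polynomial" where
  "rename \<tau> = Poly_Mapping.map_key (image_mset (Hilbert_Choice.inv \<tau>))"

context
  fixes \<tau> :: "nat \<Rightarrow> nat"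
  assumes bij: "bij \<tau>"
begin

lemma image_mset_inv_cancel [simp]:
  "image_mset (Hilbert_Choice.inv \<tau>) (image_mset \<tau> w) = w" "image_mset \<tau> (image_mset (Hilbert_Choice.inv \<tau>) w) = w"
  using bij by (simp_all add: multiset.map_comp o_def bij_is_inj bij_is_surj surj_f_inv_f)

lemma inj_image_mset_inv: "inj (image_mset (Hilbert_Choice.inv \<tau>))"
  by (rule inj_on_inverseI[where g = "image_mset \<tau>"]) simp

lemma rename_single: "rename \<tau> (Poly_Mapping.single w c) = Poly_Mapping.single (image_mset \<tau> w) c"
  using map_key_single[OF inj_image_mset_inv, of "image_mset \<tau> w" c] by (simp add: rename_def)

lemma rename_add: "rename \<tau> (p + q) = rename \<tau> p + rename \<tau> q"
  by (simp add: rename_def map_key_plus inj_image_mset_inv)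

lemma keys_rename: "Poly_Mapping.keys (rename \<tau> p) = image_mset \<tau> ` Poly_Mapping.keys p"
proof -
  have "image_mset (Hilbert_Choice.inv \<tau>) -` A = image_mset \<tau> ` A" for A
    by (auto simp: image_iff) (metis image_mset_inv_cancel(2))
  then show ?thesis by (simp add: rename_def keys_map_key inj_image_mset_inv)
qed

end

lemma polynomial_induct [case_names single add]:
  fixes p :: "'k::field polynomial"
  assumes "\<And>u c. P (Poly_Mapping.single u c)" "\<And>p q. P p \<Longrightarrow> P q \<Longrightarrow> P (p + q)"
  shows "P p"
proof -
  have "P (\<Sum>u\<in>A. Poly_Mapping.single u (Poly_Mapping.lookup p u))" if "finite A" for A
    using that
  proof (induction A rule: finite_induct)
    case empty
    then show ?case using assms(1)[of "{#}" 0] by simp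
  qed (simp add: assms)
  moreover have "p = (\<Sum>u\<in>Poly_Mapping.keys p. Poly_Mapping.single u (Poly_Mapping.lookup p u))"
    by (rule poly_mapping_eqI) (simp add: lookup_sum lookup_single when_def in_keys_iff)
  ultimately show ?thesis using finite_keys[of p] by metis
qed

lemma rename_mult:
  assumes "bij \<tau>"
  shows "rename \<tau> (p * q) = rename \<tau> p * rename \<tau> q"
proof (induction p rule: polynomial_induct)
  case (single u c)
  show ?case
  proof (induction q rule: polynomial_induct)
    case (single w e)
    then show ?case by (simp add: mult_single rename_single[OF assms])
  next
    case (add p q)
    then show ?case by (simp add: distrib_left rename_add[OF assms])
  qed
next
  case (add p p')
  then show ?case by (simp add: distrib_right rename_add[OF assms])
qed

lemma rename_rename_inv:
  assumes "bij \<tau>"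
  shows "rename (Hilbert_Choice.inv \<tau>) (rename \<tau> p) = p"
proof (induction p rule: polynomial_induct)
  case (single u c)
  then show ?case
    using assms bij_imp_bij_inv[OF assms] by (simp add: rename_single)
next
  case (add p q)
  then show ?case using assms bij_imp_bij_inv[OF assms] by (simp add: rename_add)
qed

lemma rename_algebra_iso:
  assumes \<tau>: "\<tau> permutes {1..m}"
  shows "rename \<tau> \<in> algebra_iso (T m) (T m :: 'k::field polynomial ring)"
proof -
  have bij: "bij \<tau>" "bij (Hilbert_Choice.inv \<tau>)" using \<tau> permutes_bij bij_imp_bij_inv by blast+
  have carrier: "rename \<rho> p \<in> carrier (T m)"
    if "\<rho> permutes {1..m}" "p \<in> carrier (T m)" for \<rho> and p :: "'k polynomial"
    using that permutes_image[OF that(1)] permutes_bij[OF that(1)]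
    by (fastforce simp: carrier_T keys_rename monomials_def)
  have \<tau>': "Hilbert_Choice.inv \<tau> permutes {1..m}" using \<tau> by (rule permutes_inv)
  have inv: "rename (Hilbert_Choice.inv \<tau>) (rename \<tau> p) = p" "rename \<tau> (rename (Hilbert_Choice.inv \<tau>) p) = p" for p :: "'k polynomial"
    using rename_rename_inv[OF bij(1), of p] rename_rename_inv[OF bij(2), of p] inv_inv_eq[OF bij(1)]
    by simp_all
  have "bij_betw (rename \<tau>) (carrier (T m)) (carrier (T m :: 'k polynomial ring))"
    by (rule bij_betw_byWitness[where f' = "rename (Hilbert_Choice.inv \<tau>)"])
       (auto simp: inv intro: carrier[OF \<tau>] carrier[OF \<tau>'])
  moreover have const: "rename \<tau> (const c) = const c" for c :: 'k
    by (simp add: const_def rename_single[OF bij(1)])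
  moreover have "rename \<tau> 1 = (1 :: 'k polynomial)"
    using const[of 1] by (simp add: const_def flip: zero_multiset_def)
  then have "rename \<tau> \<in> ring_hom (T m) (T m :: 'k polynomial ring)"
    by (intro ring_hom_memI) (simp_all add: carrier[OF \<tau>] rename_mult[OF bij(1)] rename_add[OF bij(1)])
  ultimately show ?thesis by (simp add: algebra_iso_def ring_iso_def)
qed

section \<open>Smoothly spreadable ideals\<close>

text \<open>
  Every residue-preserving permutation of the variables is realised by an automorphism (\<open>rename\<close>),
  and any automorphism that realises it agrees with it on monomials of the ring. This leaves a condition on
  permutations; the iterated shift of a generator lies in the ring because no generator has degree above
  \<open>ideal_deg I\<close>.
\<close>

lemma smoothly_spreadable_iff_straightenable:
  fixes I :: "'k::field polynomial set"
  assumes n: "1 \<le> n" and I: "monomial_ideal n I" "I \<noteq> {0}"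
  shows "smoothly_spreadable n I \<longleftrightarrow> straightenable (min_gens I)"
proof -
  define d where "d = ideal_deg I"
  have G: "min_gens I \<subseteq> monomials n" by (rule genideal_min_gens(1)[OF I(1)])
  have size: "size u \<le> d" if "u \<in> min_gens I" for u
    using that finite_min_gens[OF I(1)] by (simp add: d_def ideal_deg_def)
  have sigma: "(sigma ^^ n) u \<in> monomials (n * d)" if u: "u \<in> min_gens I" for u
  proof -
    have "k * n + j \<in> {1..n * d}" if "k \<in> block u j" for k j
    proof (rule position_in_range)
      have "j \<in># u" using that block_empty by blast
      then show "j \<in> {1..n}" using u G monomials_memD by blast
      show "k < d" using that block_bound[of u j] size[OF u] by auto
    qed
    then have "positions n (block u) \<subseteq> {1..n * d}" by (auto simp: positions_def simp del: atLeastAtMost_iff)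
    moreover from this have "finite (positions n (block u))" by (rule finite_subset) simp
    ultimately show ?thesis using n by (simp add: sigma_pow_eq_positions monomials_def)
  qed
  let ?iso = "\<lambda>\<tau>. \<exists>\<Phi> \<in> algebra_iso (T (n * d) :: 'k polynomial ring) (T (n * d)).
    (\<forall>j \<in> {1..n * d}. \<Phi> (var j) = var (\<tau> j)) \<and>
    (\<forall>u \<in> min_gens I. \<Phi> (mpol ((sigma ^^ n) u)) = mpol (polarization n u))"
  have iso: "?iso \<tau> \<longleftrightarrow> (\<forall>u \<in> min_gens I. image_mset \<tau> ((sigma ^^ n) u) = polarization n u)"
    (is "?L \<longleftrightarrow> ?R") if \<tau>: "\<tau> permutes {1..n * d}" for \<tau>
  proof
    assume ?L
    then obtain \<Phi> :: "'k polynomial \<Rightarrow> 'k polynomial" where \<Phi>: "\<Phi> \<in> ring_hom (T (n * d)) (T (n * d))"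
      "\<forall>j \<in> {1..n * d}. \<Phi> (var j) = var (\<tau> j)"
      "\<forall>u \<in> min_gens I. \<Phi> (mpol ((sigma ^^ n) u)) = mpol (polarization n u)"
      by (auto simp: algebra_iso_def ring_iso_def)
    then show ?R using ring_hom_mpol[OF \<Phi>(1,2) sigma] by (auto simp: mpol_eq_iff)
  next
    assume ?R
    then show ?L
      using rename_algebra_iso[OF \<tau>] permutes_bij[OF \<tau>]
      by (intro bexI[of _ "rename \<tau>"]) (auto simp: var_def mpol_def rename_single)
  qed
  have "smoothly_spreadable n I \<longleftrightarrow>
      (\<exists>\<tau>. \<tau> permutes {1..n * d} \<and> (\<forall>i \<in> {1..n * d}. [\<tau> i = i] (mod n)) \<and> ?iso \<tau>)"
    using I by (simp only: smoothly_spreadable_def Let_def d_def not_False_eq_True simp_thms)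
  also have "\<dots> \<longleftrightarrow>
      (\<exists>\<tau>. \<tau> permutes {1..n * d} \<and> (\<forall>i \<in> {1..n * d}. [\<tau> i = i] (mod n)) \<and>
        (\<forall>u\<in>min_gens I. image_mset \<tau> ((sigma ^^ n) u) = polarization n u))"
    by (intro ex_cong1 conj_cong refl iso)
  also have "\<dots> \<longleftrightarrow> straightenable (min_gens I)"
    by (rule class_preserving_iff_straightenable[OF n G size])
  finally show ?thesis .
qed

text \<open>
  The criterion treats each variable separately, and the blocks of variables that do not occur are empty.
  So \<open>v\<close> and the members of \<open>G\<close> never impose conditions on the same map. For a variable of \<open>v\<close> the
  single interval \<open>block v j\<close> is shifted down to start at 0.
\<close>

lemma straightenable_insert:
  assumes disj: "\<And>u. u \<in> G \<Longrightarrow> set_mset u \<inter> set_mset v = {}"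
  shows "straightenable (insert v G) \<longleftrightarrow> straightenable G"
proof
  assume vG: "straightenable (insert v G)"
  have "straightens f G j" if "straightens f (insert v G) j" for f j
  proof -
    have "inj_on f (\<Union>u\<in>insert v G. block u j)" using that unfolding straightens_def by (rule conjunct1)
    then have "inj_on f (\<Union>u\<in>G. block u j)" by (rule inj_on_subset) auto
    with that show ?thesis by (simp add: straightens_def)
  qed
  with vG show "straightenable G" unfolding straightenable_def by blast
next
  assume G: "straightenable G"
  have "\<exists>f. straightens f (insert v G) j" for j
  proof (cases "j \<in># v")
    case True
    then have out: "j \<notin># u" if "u \<in> G" for u using disj[OF that] by blast
    define s where "s = size {#i \<in># v. i < j#}"
    have block: "block v j = {s..<s + count v j}" by (simp add: block_def s_def)
    have "(\<Union>u\<in>insert v G. block u j) = block v j" using out by auto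
    moreover have "inj_on (\<lambda>k. k - s) (block v j)" unfolding block by (auto simp: inj_on_def)
    moreover have "(\<lambda>k. k - s) ` block v j = {..<count v j}"
    proof
      show "{..<count v j} \<subseteq> (\<lambda>k. k - s) ` block v j"
        by (rule subsetI, rule_tac x = "x + s" in image_eqI) (auto simp: block)
    qed (auto simp: block)
    ultimately have "straightens (\<lambda>k. k - s) (insert v G) j"
      using out by (simp add: straightens_def not_in_iff)
    then show ?thesis by blast
  next
    case False
    obtain f where "straightens f G j" using G unfolding straightenable_def by blast
    with False have "straightens f (insert v G) j" by (simp add: straightens_def not_in_iff)
    then show ?thesis by blast
  qed
  then show "straightenable (insert v G)" unfolding straightenable_def by blast
qed

section \<open>Minimal generators after adding a monomial\<close>

lemma min_gens_genideal_antichain: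
  assumes M: "M \<subseteq> monomials n" and anti: "\<And>u w. u \<in> M \<Longrightarrow> w \<in> M \<Longrightarrow> w \<subseteq># u \<Longrightarrow> w = u"
  shows "min_gens (genideal (T n) (mpol ` M :: 'k::field polynomial set)) = M"
proof
  show "min_gens (genideal (T n) (mpol ` M :: 'k polynomial set)) \<subseteq> M"
    using M by (rule min_gens_subset) (rule refl)
  show "M \<subseteq> min_gens (genideal (T n) (mpol ` M :: 'k polynomial set))"
  proof
    fix u assume u: "u \<in> M"
    have "w = u" if "mpol w \<in> genideal (T n) (mpol ` M :: 'k polynomial set)" "w \<subseteq># u" for w
    proof -
      from that(1) obtain x where x: "x \<in> M" "x \<subseteq># w" by (auto simp: mpol_in_genideal[OF M])
      with that(2) anti[OF u x(1)] show ?thesis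
        using subset_mset.order_trans subset_mset.antisym by blast
    qed
    then show "u \<in> min_gens (genideal (T n) (mpol ` M :: 'k polynomial set))"
      using u M by (auto simp: min_gens_def mpol_in_genideal[OF M])
  qed
qed

lemma min_gens_antichain:
  assumes "u \<in> min_gens I" "w \<in> min_gens I" "w \<subseteq># u"
  shows "w = u"
  using assms by (simp add: min_gens_def)

text \<open>
  Passing to the larger ring creates no difficulty, because an element of a monomial ideal is recognised by
  its monomials: each is divisible by a minimal generator, in either ring.
\<close>

lemma genideal_insert_mpol:
  fixes I :: "'k::field polynomial set"
  assumes "n \<le> n'" and I: "monomial_ideal n I" and v: "v \<in> monomials n'"
  shows "genideal (T n') (I \<union> {mpol v}) = genideal (T n') (mpol ` insert v (min_gens I))"
proof -
  interpret cring "T n' :: 'k polynomial ring" by (rule cring_T)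
  let ?M = "insert v (min_gens I)"
  note G = genideal_min_gens[OF I]
  have sub: "monomials n \<subseteq> monomials n'" using \<open>n \<le> n'\<close> by (fastforce simp: monomials_def)
  have M: "?M \<subseteq> monomials n'" using G(1) sub v by blast
  then have Mc: "mpol ` ?M \<subseteq> carrier (T n' :: 'k polynomial ring)" by auto
  have I_eq: "I = {p \<in> carrier (T n). \<forall>u \<in> Poly_Mapping.keys p. \<exists>w \<in> min_gens I. w \<subseteq># u}"
    using G(2) genideal_mpol[OF G(1), where 'k = 'k] by simp
  have "I \<union> {mpol v} \<subseteq> genideal (T n') (mpol ` ?M)"
  proof
    fix p assume "p \<in> I \<union> {mpol v}"
    then show "p \<in> genideal (T n') (mpol ` ?M)"
    proof
      assume "p \<in> I"
      then have "Poly_Mapping.keys p \<subseteq> monomials n" "\<forall>u \<in> Poly_Mapping.keys p. \<exists>w \<in> min_gens I. w \<subseteq># u"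
        using I_eq by (auto simp: carrier_T)
      then show ?thesis using sub by (auto simp: genideal_mpol[OF M] carrier_T simp del: image_insert)
    next
      assume "p \<in> {mpol v}"
      then show ?thesis using genideal_self[OF Mc] by auto
    qed
  qed
  then have le: "genideal (T n') (I \<union> {mpol v}) \<subseteq> genideal (T n') (mpol ` ?M)"
    by (rule genideal_minimal[OF genideal_ideal[OF Mc]])
  have Ic: "I \<union> {mpol v} \<subseteq> carrier (T n' :: 'k polynomial ring)"
  proof -
    have "I \<subseteq> carrier (T n)" using I_eq by blast
    also have "\<dots> \<subseteq> carrier (T n')" using sub by (auto simp: carrier_T)
    finally show ?thesis using v by simp
  qed
  have "mpol ` ?M \<subseteq> I \<union> {mpol v}" by (auto simp: min_gens_def)
  then have "mpol ` ?M \<subseteq> genideal (T n') (I \<union> {mpol v})"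
    using genideal_self[OF Ic] by blast
  then have "genideal (T n') (mpol ` ?M) \<subseteq> genideal (T n') (I \<union> {mpol v})"
    by (rule genideal_minimal[OF genideal_ideal[OF Ic]])
  with le show ?thesis by blast
qed

theorem proposition1p10:
  fixes I J :: "'k::field polynomial set"
    and v :: monomial
    and n n' :: nat
  assumes "1 \<le> n" "n < n'"
    and "monomial_ideal n I" "I \<noteq> {0}"
    and "v \<in> monomials n'" "v \<noteq> {#}" "set_mset v \<subseteq> {n + 1..n'}"
    and "J = genideal (T n') (I \<union> {mpol v})"
  shows "smoothly_spreadable n I \<longleftrightarrow> smoothly_spreadable n' J"
proof -
  let ?G = "min_gens I"
  have G: "?G \<subseteq> monomials n" by (rule genideal_min_gens(1)[OF assms(3)])
  have M: "insert v ?G \<subseteq> monomials n'"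
    using G assms(2,5) by (fastforce simp: monomials_def)
  have J: "J = genideal (T n') (mpol ` insert v ?G)"
    using genideal_insert_mpol[OF _ assms(3,5)] assms(2,8) by simp
  have disj: "set_mset u \<inter> set_mset v = {}" if "u \<in> ?G" for u
    using that G assms(7) by (fastforce simp: monomials_def)
  (* In the unit ideal the generator 1 divides v, so v is not a minimal generator of J. *)
  have "straightenable (min_gens J) \<longleftrightarrow> straightenable ?G"
  proof (cases "{#} \<in> ?G")
    case True
    then have G1: "?G = {{#}}" by (auto dest: min_gens_antichain)
    have "J = genideal (T n') (mpol ` {{#}})"
      unfolding J using M by (auto simp: G1 genideal_mpol monomials_def simp del: image_insert)
    then have "min_gens J = {{#}}"
      using min_gens_genideal_antichain[of "{{#}}" n', where 'k = 'k] by (simp add: monomials_def)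
    with G1 show ?thesis by simp
  next
    case False
    have nonunit: "u \<noteq> {#}" if "u \<in> insert v ?G" for u
      using that False assms(6) by auto
    have indep: "w \<noteq> {#} \<Longrightarrow> set_mset u \<inter> set_mset w = {} \<Longrightarrow> \<not> w \<subseteq># u" for u w :: monomial
      using set_mset_mono[of w u] by auto
    have "min_gens J = insert v ?G"
      unfolding J using M
    proof (rule min_gens_genideal_antichain)
      fix u w assume uw: "u \<in> insert v ?G" "w \<in> insert v ?G" "w \<subseteq># u"
      then have "\<not> set_mset u \<inter> set_mset w = {}" using indep nonunit by blast
      with uw disj show "w = u" by (auto dest: min_gens_antichain simp: Int_commute)
    qed
    then show ?thesis using straightenable_insert[OF disj] by simp
  qed
  moreover have "monomial_ideal n' J" using J M unfolding monomial_ideal_def by blast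
  moreover have "J \<noteq> {0}"
  proof -
    have "(mpol v :: 'k polynomial) \<in> J" unfolding J mpol_in_genideal[OF M] using M by blast
    moreover have "(mpol v :: 'k polynomial) \<noteq> 0" using keys_mpol[of v, where 'k = 'k] by force
    ultimately show ?thesis by blast
  qed
  ultimately show ?thesis
    using smoothly_spreadable_iff_straightenable assms(1-4) by (metis less_imp_le order_trans)
qed

end
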